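(* Let $k\ge 1$ and $n\geq 3$ be integers, let $r\in\mathbb{C}\setminus\{0\}$, and let $\alpha,\beta,\gamma$ be the (distinct) roots in $\mathbb{C}$ of $\phi(x)=x^3-2kx^2-kx-1$. Set $\omega_n=e^{2\pi i/n}$ and $\rho_m=r^{1/n}\omega_n^m$ for $m=0,1,\ldots,n-1$, where $r^{1/n}$ is a fixed $n$-th root of $r$. Assume that $\rho_m\notin\{\alpha^{-1},\beta^{-1},\gamma^{-1}\}$ for all $m=0,1,\ldots,n-1$. Then the determinant of $\mathbf{P}_n=\mathrm{Circ}_r(P_{k,0},P_{k,1},\ldots,P_{k,n-1})$ is $$\det(\mathbf{P}_n)=(-1)^n\,\frac{r^nP_{k,n-1}^n(r_1^n-r)(r_2^n-r)}{(\alpha^{-n}-r)(\beta^{-n}-r)(\gamma^{-n}-r)},$$ where $r_1,r_2\in\mathbb{C}$ satisfy $$r_1+r_2=-\frac{rkP_{k,n-1}+rP_{k,n-2}-1}{rP_{k,n-1}},\qquad r_1r_2=\frac{P_{k,n}}{P_{k,n-1}}.$$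
   Context: For an integer $k\geq 1$, the generalized $k$-Pell-Tribonacci sequence $(P_{k,n})_{n\ge 0}$ is defined by $P_{k,0}=0$, $P_{k,1}=1$, $P_{k,2}=2k$ and $P_{k,n}=2kP_{k,n-1}+kP_{k,n-2}+P_{k,n-3}$ for $n\geq 3$. Its characteristic polynomial is $\phi(x)=x^3-2kx^2-kx-1$, which has three distinct complex roots. For $n\ge 2$, $r\in\mathbb{C}$ and $a_0,\dots,a_{n-1}\in\mathbb{C}$, the $r$-circulant matrix $\mathrm{Circ}_r(a_0,\dots,a_{n-1})$ is the $n\times n$ matrix whose $(i,j)$ entry ($1\le i,j\le n$) is $a_{j-i}$ if $j\ge i$ and $r\,a_{n+j-i}$ if $j<i$. *)

theory Defs
  imports Complex_Main "Jordan_Normal_Form.Char_Poly"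
begin

fun pell_tribonacci :: "nat \<Rightarrow> nat \<Rightarrow> nat" where
  "pell_tribonacci k 0 = 0"
| "pell_tribonacci k (Suc 0) = 1"
| "pell_tribonacci k (Suc (Suc 0)) = 2 * k"
| "pell_tribonacci k (Suc (Suc (Suc n))) =
     2 * k * pell_tribonacci k (Suc (Suc n)) + k * pell_tribonacci k (Suc n) + pell_tribonacci k n"

definition pell_tribonacci_charpoly :: "nat \<Rightarrow> complex poly" where
  "pell_tribonacci_charpoly k = [:- 1, - of_nat k, - 2 * of_nat k, 1:]"

text \<open>Rows and columns are indexed from 0; the entries depend only on the difference of the two
  indices, so this agrees with the indexing from 1. Only the values \<open>a 0, \<dots>, a (n - 1)\<close> are used.\<close>

definition r_circulant :: "nat \<Rightarrow> complex \<Rightarrow> (nat \<Rightarrow> complex) \<Rightarrow> complex mat" where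
  "r_circulant n r a = mat n n (\<lambda>(i, j). if i \<le> j then a (j - i) else r * a (n + j - i))"

lemma pell_tribonacci_charpoly_distinct_roots:
  "\<exists>\<alpha> \<beta> \<gamma>. distinct [\<alpha>, \<beta>, \<gamma>] \<and>
     {x. poly (pell_tribonacci_charpoly k) x = 0} = {\<alpha>, \<beta>, \<gamma>}"
proof -
  let ?p = "pell_tribonacci_charpoly k"
  define K :: complex where "K = of_nat k"
  have p: "?p = [:- 1, - K, - 2 * K, 1:]"
    by (simp add: pell_tribonacci_charpoly_def K_def)
  have "\<not> (poly ?p x = 0 \<and> poly (pderiv ?p) x = 0)" for x
  proof
    assume "poly ?p x = 0 \<and> poly (pderiv ?p) x = 0"
    then have f: "x ^ 3 - 2 * K * x ^ 2 - K * x - 1 = 0" and g: "3 * x ^ 2 - 4 * K * x - K = 0"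
      by (simp_all add: p pderiv_pCons algebra_simps power2_eq_square power3_eq_cube)
    define l where "l = (8 * K\<^sup>2 + 6 * K) * x + (2 * K\<^sup>2 + 9)"
    have "l = - (9 * (x ^ 3 - 2 * K * x ^ 2 - K * x - 1) + (2 * K - 3 * x) * (3 * x ^ 2 - 4 * K * x - K))"
      by (simp add: l_def algebra_simps power2_eq_square power3_eq_cube power4_eq_xxxx)
    then have l: "l = 0" by (simp add: f g)
    define D where "D = 4 * K ^ 4 - 28 * K ^ 3 - 36 * K ^ 2 - 27"
    have "9 * D =
        l * (3 * ((8 * K\<^sup>2 + 6 * K) * x - (2 * K\<^sup>2 + 9)) - 4 * K * (8 * K\<^sup>2 + 6 * K))
        - (8 * K\<^sup>2 + 6 * K) ^ 2 * (3 * x ^ 2 - 4 * K * x - K)"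
      by (simp add: l_def D_def algebra_simps power2_eq_square power3_eq_cube power4_eq_xxxx)
    then have "D = 0"
      by (simp add: l g)
    then have "of_int (4 * int k ^ 4 - 28 * int k ^ 3 - 36 * int k ^ 2 - 27) = (0 :: complex)"
      by (simp add: K_def D_def)
    then have "4 * int k ^ 4 - 28 * int k ^ 3 - 36 * int k ^ 2 = 27"
      by (simp only: of_int_eq_0_iff)
    moreover have "even (4 * int k ^ 4 - 28 * int k ^ 3 - 36 * int k ^ 2)"
      by simp
    ultimately show False by simp
  qed
  then have "rsquarefree ?p"
    by (simp add: rsquarefree_roots)
  then have "card {x. poly ?p x = 0} = 3"
    by (subst (asm) rsquarefree_card_degree) (simp_all add: p)
  then obtain \<alpha> \<beta> \<gamma> where "{x. poly ?p x = 0} = {\<alpha>, \<beta>, \<gamma>}" "distinct [\<alpha>, \<beta>, \<gamma>]"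
    by (auto simp: card_3_iff)
  then show ?thesis by blast
qed

end

theory Submission
  imports Defs
begin

text \<open>For every \<open>n\<close>-th root \<open>x\<close> of \<open>r\<close>, the vector \<open>(1, x, \<dots>, x\<^bsup>n-1\<^esup>)\<close> is an eigenvector of
  \<open>Circ\<^sub>r(a\<^sub>0, \<dots>, a\<^bsub>n-1\<^esub>)\<close> with eigenvalue \<open>\<Sum>j<n. a\<^sub>j x\<^sup>j\<close>. These \<open>n\<close> vectors form an invertible Vandermonde
  matrix, so the determinant is the product of the eigenvalues. By the recurrence, each eigenvalue
  is the quotient of \<open>- r P\<^bsub>k,n-1\<^esub> (x - r\<^sub>1) (x - r\<^sub>2)\<close> and \<open>(1 - \<alpha>x) (1 - \<beta>x) (1 - \<gamma>x)\<close>, where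
  \<open>\<alpha>\<beta>\<gamma> = 1\<close>, and the products of the linear factors are evaluated by \<open>\<Prod>\<^sub>x (a - x) = a\<^sup>n - r\<close>.\<close>

lemma inj_on_nth_roots:
  assumes "n > 0" and "s \<noteq> 0"
  shows "inj_on (\<lambda>m. s * exp (2 * of_real pi * \<i> / of_nat n) ^ m) {..<n}"
proof -
  \<comment> \<open>The powers of the exponential are rewritten as the \<open>cis\<close> values
    with which the library enumerates the roots of unity; scaling by \<open>s\<close> keeps them
    distinct.\<close>
  have "exp (2 * of_real pi * \<i> / of_nat n) ^ m = cis (2 * pi * real m / real n)" for m
    by (simp add: cis_conv_exp mult_ac flip: exp_of_nat_mult)
  then show ?thesis
    using bij_betw_imp_inj_on[OF bij_betw_roots_unity[OF assms(1)]] assms(2)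
    by (simp add: inj_on_def)
qed

lemma nth_root_times_unity_root_power:
  fixes s :: complex
  assumes "n > 0"
  shows "(s * exp (2 * of_real pi * \<i> / of_nat n) ^ m) ^ n = s ^ n"
proof -
  have "(exp (2 * of_real pi * \<i> / of_nat n) ^ m) ^ n = (exp (2 * of_real pi * \<i> / of_nat n) ^ n) ^ m"
    by (simp add: mult.commute flip: power_mult)
  also have "exp (2 * of_real pi * \<i> / of_nat n) ^ n = 1"
    using assms by (simp flip: exp_of_nat_mult)
  finally show ?thesis
    by (simp add: power_mult_distrib)
qed

text \<open>As polynomials in \<open>a\<close>, both sides are monic of degree \<open>n\<close> and
  agree at the \<open>n\<close> distinct points \<open>\<rho> m\<close>, so they coincide.\<close>

lemma prod_diff_nth_roots:
  fixes \<rho> :: "nat \<Rightarrow> 'a::idom"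
  assumes "n > 0" and inj: "inj_on \<rho> {..<n}" and root: "\<And>m. m < n \<Longrightarrow> \<rho> m ^ n = r"
  shows "(\<Prod>m<n. a - \<rho> m) = a ^ n - r"
proof -
  let ?p = "\<Prod>m<n. [:- \<rho> m, 1:]"
  let ?q = "monom 1 n - [:r:]"
  have deg: "degree ?p = n"
    by (simp add: degree_prod_eq_sum_degree)
  have "lead_coeff ?p = 1"
    by (simp add: lead_coeff_prod)
  \<comment> \<open>Since \<open>n > 0\<close>, the constant \<open>r\<close> does not touch the
    coefficient of degree \<open>n\<close>.\<close>
  then have "coeff ?p n = coeff ?q n"
    using assms(1) deg by (simp add: coeff_pCons split: nat.split)
  moreover have "degree ?q \<le> n"
    by (intro degree_diff_le) (simp_all add: degree_monom_le)
  moreover have "poly ?p z = poly ?q z" if "z \<in> \<rho> ` {..<n}" for z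
    using that by (auto simp: poly_prod poly_monom root)
  ultimately have "?p = ?q"
    using deg inj by (intro poly_eqI_degree_lead_coeff[where A = "\<rho> ` {..<n}" and n = n])
      (simp_all add: card_image)
  from arg_cong[OF this, of "\<lambda>p. poly p a"] show ?thesis
    by (simp add: poly_prod poly_monom)
qed

text \<open>A kernel vector lists the coefficients of a polynomial of degree below \<open>n\<close>
  that vanishes at \<open>n\<close> distinct points, so it must be zero.\<close>

lemma det_vandermonde_nonzero:
  fixes x :: "nat \<Rightarrow> 'a::field"
  assumes inj: "inj_on x {..<n}"
  shows "det (mat n n (\<lambda>(i, j). x i ^ j)) \<noteq> 0" (is "det ?V \<noteq> 0")
proof
  assume "det ?V = 0"
  then obtain v where v: "v \<in> carrier_vec n" "v \<noteq> 0\<^sub>v n" "?V *\<^sub>v v = 0\<^sub>v n"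
    using det_0_iff_vec_prod_zero_field[of ?V n] by auto
  define p where "p = (\<Sum>j<n. monom (v $ j) j)"
  \<comment> \<open>In dimension 0 there is no nonzero vector.\<close>
  have n: "n > 0"
    using v by (cases n) auto
  have "poly p (x i) = 0" if "i < n" for i
  proof -
    have "poly p (x i) = (\<Sum>j<n. x i ^ j * v $ j)"
      by (simp add: p_def poly_sum poly_monom mult.commute)
    also have "\<dots> = (?V *\<^sub>v v) $ i"
      using that v(1) by (simp add: scalar_prod_def lessThan_atLeast0)
    finally show ?thesis
      using v(3) that by simp
  qed
  moreover have "degree p < n"
    unfolding p_def using n
    by (intro le_less_trans[OF degree_sum_le[where n = "n - 1"]])
      (auto intro: order.trans[OF degree_monom_le])
  ultimately have "p = 0"
    using inj n by (intro poly_eqI_degree[where A = "x ` {..<n}"]) (auto simp: card_image)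
  have "v $ j = 0" if "j < n" for j
  proof -
    have "coeff p j = v $ j"
      using that by (simp add: p_def coeff_sum)
    with \<open>p = 0\<close> show ?thesis by simp
  qed
  with v(1,2) show False
    by (auto simp: vec_eq_iff)
qed

text \<open>Row \<open>i\<close> is the first row shifted cyclically by \<open>i\<close>. On powers
  of \<open>x\<close> a shift is multiplication by \<open>x ^ i\<close>, and the factor
  \<open>r = x ^ n\<close> on the entries that wrap around corrects their exponents.\<close>

lemma r_circulant_row_eigenvector:
  assumes "x ^ n = r" and "i < n"
  shows "(\<Sum>j<n. r_circulant n r a $$ (i, j) * x ^ j) = x ^ i * (\<Sum>j<n. a j * x ^ j)"
proof -
  let ?f = "\<lambda>j. r_circulant n r a $$ (i, j) * x ^ j"
  let ?g = "\<lambda>j. x ^ i * (a j * x ^ j)"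
  \<comment> \<open>From the diagonal on, column \<open>j\<close> carries \<open>a (j - i)\<close>:
    a plain shift.\<close>
  have "sum ?f {i..<n} = sum ?g {0..<n - i}"
    using assms(2)
    by (intro sum.reindex_bij_witness[of _ "\<lambda>j. j + i" "\<lambda>j. j - i"])
      (auto simp: r_circulant_def simp flip: power_add)
  \<comment> \<open>Left of the diagonal the index wraps around to \<open>n + j - i\<close>.\<close>
  moreover have "sum ?f {0..<i} = sum ?g {n - i..<n}"
  proof (intro sum.reindex_bij_witness[of _ "\<lambda>j. j + i - n" "\<lambda>j. n + j - i"])
    fix j assume "j \<in> {0..<i}"
    then have "j < i" by simp
    have "x ^ i * x ^ (n + j - i) = r * x ^ j"
      using assms \<open>j < i\<close> by (auto simp flip: power_add)
    then show "?g (n + j - i) = ?f j"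
      using assms(2) \<open>j < i\<close> by (simp add: r_circulant_def mult_ac)
  qed (use assms(2) in auto)
  ultimately have "sum ?f {0..<n} = sum ?g {0..<n}"
    using assms(2) sum.atLeastLessThan_concat[of 0 i n ?f] sum.atLeastLessThan_concat[of 0 "n - i" n ?g]
    by (simp add: add.commute)
  then show ?thesis
    by (simp add: lessThan_atLeast0 sum_distrib_left)
qed

text \<open>The columns of the transposed Vandermonde matrix are eigenvectors, so the circulant is
  conjugate to the diagonal matrix of its eigenvalues.\<close>

lemma det_r_circulant:
  assumes inj: "inj_on \<rho> {..<n}" and root: "\<And>m. m < n \<Longrightarrow> \<rho> m ^ n = r"
  shows "det (r_circulant n r a) = (\<Prod>m<n. \<Sum>j<n. a j * \<rho> m ^ j)"
proof -
  let ?C = "r_circulant n r a"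
  define V where "V = mat n n (\<lambda>(i, j). \<rho> i ^ j)"
  define D where "D = mat n n (\<lambda>(i, m). if i = m then \<Sum>j<n. a j * \<rho> m ^ j else 0)"
  have carrier: "?C \<in> carrier_mat n n" "V \<in> carrier_mat n n" "D \<in> carrier_mat n n"
    by (simp_all add: r_circulant_def V_def D_def)
  have "?C * transpose_mat V = transpose_mat V * D"
  proof (rule eq_matI)
    fix i m assume "i < dim_row (transpose_mat V * D)" "m < dim_col (transpose_mat V * D)"
    then have im: "i < n" "m < n" by (simp_all add: V_def D_def)
    have "(?C * transpose_mat V) $$ (i, m) = (\<Sum>j<n. ?C $$ (i, j) * \<rho> m ^ j)"
      using im carrier by (simp add: scalar_prod_def V_def lessThan_atLeast0)
    also have "\<dots> = \<rho> m ^ i * (\<Sum>j<n. a j * \<rho> m ^ j)"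
      using im root by (intro r_circulant_row_eigenvector)
    \<comment> \<open>The single term is spread into a sum over \<open>l\<close> to match the matrix
      product with the diagonal matrix \<open>D\<close>.\<close>
    also have "\<dots> = (\<Sum>l<n. if l = m then \<rho> l ^ i * (\<Sum>j<n. a j * \<rho> m ^ j) else 0)"
      using im by simp
    also have "\<dots> = (transpose_mat V * D) $$ (i, m)"
      using im by (auto simp: scalar_prod_def V_def D_def lessThan_atLeast0 if_distrib cong: if_cong)
    finally show "(?C * transpose_mat V) $$ (i, m) = (transpose_mat V * D) $$ (i, m)" .
  qed (use carrier in auto)
  then have "det ?C * det V = det V * det D"
    using carrier by (metis det_mult det_transpose transpose_carrier_mat)
  moreover have "det V \<noteq> 0"
    unfolding V_def using inj by (rule det_vandermonde_nonzero)
  ultimately have "det ?C = det D" by simp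
  also have "\<dots> = prod_list (diag_mat D)"
    using carrier by (intro det_upper_triangular) (auto simp: D_def)
  also have "\<dots> = (\<Prod>m<n. \<Sum>j<n. a j * \<rho> m ^ j)"
    by (simp add: prod_list_diag_prod D_def lessThan_atLeast0)
  finally show ?thesis .
qed

text \<open>Used to divide by the entry of index \<open>n - 1\<close>.\<close>

lemma pell_tribonacci_pos: "k \<ge> 1 \<Longrightarrow> n \<ge> 1 \<Longrightarrow> pell_tribonacci k n > 0"
  by (induction k n rule: pell_tribonacci.induct) auto

text \<open>The truncated generating function is multiplied by the reversed characteristic
  polynomial. The recurrence cancels the middle coefficients; the initial values leave
  \<open>x\<close>, and the truncation leaves the three top terms.\<close>

lemma pell_tribonacci_generating_sum:
  fixes x :: "'a::comm_ring_1"
  shows "(\<Sum>j<Suc (Suc m). of_nat (pell_tribonacci k j) * x ^ j)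
      * (1 - 2 * of_nat k * x - of_nat k * x ^ 2 - x ^ 3)
    = x - of_nat (pell_tribonacci k (Suc (Suc m))) * x ^ Suc (Suc m)
      - (of_nat k * of_nat (pell_tribonacci k (Suc m)) + of_nat (pell_tribonacci k m)) * x ^ (m + 3)
      - of_nat (pell_tribonacci k (Suc m)) * x ^ (m + 4)"
proof (induction m)
  case 0
  then show ?case
    by (simp add: algebra_simps eval_nat_numeral)
next
  case (Suc m)
  \<comment> \<open>The new summand cancels the old term of degree \<open>m + 2\<close>, and the
    recurrence collects degree \<open>m + 3\<close> into the next sequence value.\<close>
  show ?case
    by (subst sum.lessThan_Suc, subst distrib_right, subst Suc)
      (simp add: algebra_simps eval_nat_numeral)
qed

text \<open>Two monic cubics that agree at three distinct points are equal. The factored form gives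
  access to Vieta's formulas.\<close>

lemma pell_tribonacci_charpoly_factors:
  assumes "distinct [\<alpha>, \<beta>, \<gamma>]"
    and "{x. poly (pell_tribonacci_charpoly k) x = 0} = {\<alpha>, \<beta>, \<gamma>}"
  shows "pell_tribonacci_charpoly k = [:- \<alpha>, 1:] * [:- \<beta>, 1:] * [:- \<gamma>, 1:]"
proof (rule poly_eqI_degree_lead_coeff[where A = "{\<alpha>, \<beta>, \<gamma>}" and n = 3])
  fix z assume "z \<in> {\<alpha>, \<beta>, \<gamma>}"
  moreover from this have "poly (pell_tribonacci_charpoly k) z = 0"
    using assms(2) by blast
  ultimately show "poly (pell_tribonacci_charpoly k) z = poly ([:- \<alpha>, 1:] * [:- \<beta>, 1:] * [:- \<gamma>, 1:]) z"
    by (auto simp del: mult_pCons_left mult_pCons_right)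
qed (use assms(1) in \<open>auto simp: pell_tribonacci_charpoly_def eval_nat_numeral\<close>)

text \<open>At \<open>x ^ n = r\<close> the top terms of the generating sum drop to degree at most
  2, and the conditions on \<open>u\<close> and \<open>v\<close> say that these are the roots of the
  resulting quadratic. Division is postponed until the product over all \<open>x\<close> is
  taken.\<close>

lemma pell_tribonacci_sum_at_nth_root:
  fixes x r u v \<alpha> \<beta> \<gamma> :: complex
  assumes "k \<ge> 1" and "n \<ge> 2" and "r \<noteq> 0" and "x ^ n = r"
    and factors: "pell_tribonacci_charpoly k = [:- \<alpha>, 1:] * [:- \<beta>, 1:] * [:- \<gamma>, 1:]"
    and sum_uv: "u + v =
           - ((r * of_nat k * of_nat (pell_tribonacci k (n - 1))
               + r * of_nat (pell_tribonacci k (n - 2)) - 1)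
              / (r * of_nat (pell_tribonacci k (n - 1))))"
    and prod_uv: "u * v = of_nat (pell_tribonacci k n) / of_nat (pell_tribonacci k (n - 1))"
  shows "(\<Sum>j<n. of_nat (pell_tribonacci k j) * x ^ j)
      * ((inverse \<alpha> - x) * (inverse \<beta> - x) * (inverse \<gamma> - x))
    = - (r * of_nat (pell_tribonacci k (n - 1))) * ((u - x) * (v - x))"
proof -
  obtain m where n: "n = Suc (Suc m)"
    using assms(2) by (metis add_2_eq_Suc le_Suc_ex)
  define p0 p1 p2 :: complex where p: "p0 = of_nat (pell_tribonacci k m)"
    "p1 = of_nat (pell_tribonacci k (Suc m))" "p2 = of_nat (pell_tribonacci k (Suc (Suc m)))"
  have "p1 \<noteq> 0"
    using pell_tribonacci_pos[of k "Suc m"] assms(1) by (simp add: p)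
  have vieta: "\<alpha> * \<beta> * \<gamma> = 1" "\<alpha> * \<beta> + \<alpha> * \<gamma> + \<beta> * \<gamma> = - of_nat k" "\<alpha> + \<beta> + \<gamma> = 2 * of_nat k"
    using factors by (simp_all add: pell_tribonacci_charpoly_def algebra_simps)
  then have nz: "\<alpha> \<noteq> 0" "\<beta> \<noteq> 0" "\<gamma> \<noteq> 0"
    by auto
  have "(inverse \<alpha> - x) * (inverse \<beta> - x) * (inverse \<gamma> - x)
      = (1 - \<alpha> * x) * (1 - \<beta> * x) * (1 - \<gamma> * x) / (\<alpha> * \<beta> * \<gamma>)"
    using nz by (simp add: field_simps)
  also have "\<dots> = (1 - \<alpha> * x) * (1 - \<beta> * x) * (1 - \<gamma> * x)"
    by (simp add: vieta(1))
  also have "\<dots> = 1 - (\<alpha> + \<beta> + \<gamma>) * x + (\<alpha> * \<beta> + \<alpha> * \<gamma> + \<beta> * \<gamma>) * x ^ 2 - (\<alpha> * \<beta> * \<gamma>) * x ^ 3"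
    by (simp add: algebra_simps eval_nat_numeral)
  also have "\<dots> = 1 - 2 * of_nat k * x - of_nat k * x ^ 2 - x ^ 3"
    unfolding vieta by simp
  finally have "(\<Sum>j<n. of_nat (pell_tribonacci k j) * x ^ j)
      * ((inverse \<alpha> - x) * (inverse \<beta> - x) * (inverse \<gamma> - x))
    = x - p2 * x ^ n - (of_nat k * p1 + p0) * (x ^ n * x) - p1 * (x ^ n * x ^ 2)"
    using pell_tribonacci_generating_sum[of k x m]
    by (simp add: n p power_add[symmetric] eval_nat_numeral mult_ac)
  also have "\<dots> = x - r * p2 - r * (of_nat k * p1 + p0) * x - r * p1 * x ^ 2"
    unfolding assms(4) by (simp add: algebra_simps)
  \<comment> \<open>Coefficients match because
    \<open>r * p1 * (u + v) = 1 - r * (of_nat k * p1 + p0)\<close> and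
    \<open>p1 * (u * v) = p2\<close>.\<close>
  also have "\<dots> = - (r * p1) * (u * v - (u + v) * x + x ^ 2)"
    using \<open>p1 \<noteq> 0\<close> assms(3) unfolding sum_uv prod_uv
    by (simp add: n p[symmetric] field_simps power2_eq_square)
  also have "\<dots> = - (r * p1) * ((u - x) * (v - x))"
    by (simp add: algebra_simps power2_eq_square)
  finally show ?thesis
    by (simp add: n p)
qed

theorem theorem4:
  fixes k n :: nat and r s \<alpha> \<beta> \<gamma> r\<^sub>1 r\<^sub>2 :: complex
  assumes "k \<ge> 1" and "n \<ge> 3" and "r \<noteq> 0"
    and "distinct [\<alpha>, \<beta>, \<gamma>]"
    and "{x. poly (pell_tribonacci_charpoly k) x = 0} = {\<alpha>, \<beta>, \<gamma>}"
    and "s ^ n = r"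
    and "\<And>m. m < n \<Longrightarrow>
           s * exp (2 * of_real pi * \<i> / of_nat n) ^ m \<notin> {inverse \<alpha>, inverse \<beta>, inverse \<gamma>}"
    and "r\<^sub>1 + r\<^sub>2 =
           - ((r * of_nat k * of_nat (pell_tribonacci k (n - 1))
               + r * of_nat (pell_tribonacci k (n - 2)) - 1)
              / (r * of_nat (pell_tribonacci k (n - 1))))"
    and "r\<^sub>1 * r\<^sub>2 = of_nat (pell_tribonacci k n) / of_nat (pell_tribonacci k (n - 1))"
  shows "det (r_circulant n r (\<lambda>j. of_nat (pell_tribonacci k j))) =
           (- 1) ^ n *
           (r ^ n * of_nat (pell_tribonacci k (n - 1)) ^ n * (r\<^sub>1 ^ n - r) * (r\<^sub>2 ^ n - r)
            / ((\<alpha> powi (- int n) - r) * (\<beta> powi (- int n) - r) * (\<gamma> powi (- int n) - r)))"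
proof -
  define \<rho> where "\<rho> = (\<lambda>m. s * exp (2 * of_real pi * \<i> / of_nat n) ^ m)"
  define S where "S = (\<lambda>m. \<Sum>j<n. of_nat (pell_tribonacci k j) * \<rho> m ^ j)"
  let ?p = "of_nat (pell_tribonacci k (n - 1)) :: complex"
  have n: "n > 0" using assms(2) by simp
  have "s \<noteq> 0" using assms(3,6) n by auto
  have inj: "inj_on \<rho> {..<n}"
    unfolding \<rho>_def using n \<open>s \<noteq> 0\<close> by (rule inj_on_nth_roots)
  have root: "\<rho> m ^ n = r" for m
    using nth_root_times_unity_root_power[OF n] assms(6) by (simp add: \<rho>_def)
  have eigen_prod: "(\<Prod>m<n. a - \<rho> m) = a ^ n - r" for a
    using n inj root by (rule prod_diff_nth_roots)
  \<comment> \<open>Written as a product over the \<open>\<rho> m\<close>, this vanishes only if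
    some \<open>\<rho> m\<close> equals the inverse of a root of the cubic.\<close>
  have nonzero: "a ^ n - r \<noteq> 0" if "a \<in> {inverse \<alpha>, inverse \<beta>, inverse \<gamma>}" for a
    unfolding eigen_prod[symmetric] using assms(7) that by (auto simp: \<rho>_def)
  have "(\<Prod>m<n. S m * ((inverse \<alpha> - \<rho> m) * (inverse \<beta> - \<rho> m) * (inverse \<gamma> - \<rho> m)))
      = (\<Prod>m<n. - (r * ?p) * ((r\<^sub>1 - \<rho> m) * (r\<^sub>2 - \<rho> m)))"
    unfolding S_def using assms(1,2,3,8,9) root pell_tribonacci_charpoly_factors[OF assms(4,5)]
    by (intro prod.cong refl pell_tribonacci_sum_at_nth_root) auto
  then have "prod S {..<n} * ((inverse \<alpha> ^ n - r) * (inverse \<beta> ^ n - r) * (inverse \<gamma> ^ n - r))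
      = (- (r * ?p)) ^ n * ((r\<^sub>1 ^ n - r) * (r\<^sub>2 ^ n - r))"
    by (simp only: prod.distrib eigen_prod prod_constant card_lessThan)
  \<comment> \<open>The sign in the final formula comes from the leading coefficient of the
    quadratic, taken once for each of the \<open>n\<close> eigenvalues.\<close>
  also have "(- (r * ?p)) ^ n = (- 1) ^ n * (r ^ n * ?p ^ n)"
    by (subst power_minus) (simp add: power_mult_distrib)
  finally have "prod S {..<n} = (- 1) ^ n * (r ^ n * ?p ^ n * (r\<^sub>1 ^ n - r) * (r\<^sub>2 ^ n - r)
      / ((inverse \<alpha> ^ n - r) * (inverse \<beta> ^ n - r) * (inverse \<gamma> ^ n - r)))"
    using nonzero by (simp add: eq_divide_eq mult.assoc del: power_inverse)
  moreover have "det (r_circulant n r (\<lambda>j. of_nat (pell_tribonacci k j))) = prod S {..<n}"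
    unfolding S_def using inj root by (rule det_r_circulant)
  moreover have "z powi (- int n) = inverse z ^ n" for z :: complex
    by (simp add: power_int_minus power_inverse)
  ultimately show ?thesis by simp
qed

end
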